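(* Let $\underline{a}=(a_1,\ldots,a_n)$ be a sequence of positive integers with $a_1<\cdots<a_n$. Then there is an integer $N$ such that for every integer $j\ge N$: if $\underline{a}+(\underline{j})=(j,j+a_1,\ldots,j+a_n)$ is a complete intersection sequence, then $\underline{a}=(a_1,\ldots,a_n)$ is a complete intersection sequence.
   Context: Let $K$ be a field of characteristic zero. A strictly increasing sequence of positive integers $(e_0,\ldots,e_r)$ is called a complete intersection sequence if the ring $K[t^{e_0},\ldots,t^{e_r}]$ is a complete intersection, i.e. the kernel $I$ of the $K$-algebra map $K[x_0,\ldots,x_r]\to K[t]$, $x_i\mapsto t^{e_i}$ (the defining ideal of the monomial curve $(t^{e_0},\ldots,t^{e_r})$, an ideal of height $r$), can be generated by $r$ elements. For $\underline{a}=(a_1,\ldots,a_n)$ and a positive integer $j$, $\underline{a}+(\underline{j})$ denotes the sequence $(j,j+a_1,\ldots,j+a_n)$. *)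

theory Defs
  imports
    "HOL-Library.Poly_Mapping"
    "HOL-Computational_Algebra.Polynomial"
    "HOL-Algebra.Ideal"
begin

text \<open>
  A polynomial over \<open>'k\<close> is a finitely supported map from monomials to coefficients, a monomial
  being a finitely supported map from variable indices to exponents. The product on this type is
  the convolution product of \<^theory>\<open>HOL-Library.Poly_Mapping\<close>.
\<close>

type_synonym 'k mpoly = "(nat \<Rightarrow>\<^sub>0 nat) \<Rightarrow>\<^sub>0 'k"

text \<open>\<open>mpoly_ring m\<close> is the ring in the \<open>m\<close> variables \<open>x\<^sub>0, \<dots>, x\<^bsub>m-1\<^esub>\<close>.\<close>

definition mpoly_ring :: "nat \<Rightarrow> 'k::field mpoly ring" where
  "mpoly_ring m =
    \<lparr>carrier = {p. \<forall>\<mu>\<in>Poly_Mapping.keys p. Poly_Mapping.keys \<mu> \<subseteq> {..<m}},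
     mult = (*), one = 1, zero = 0, add = (+)\<rparr>"

text \<open>The substitution \<open>x\<^sub>i \<mapsto> t\<^bsup>e\<^sub>i\<^esup>\<close>.\<close>

definition curve_map :: "nat list \<Rightarrow> 'k::field mpoly \<Rightarrow> 'k poly" where
  "curve_map e p =
    (\<Sum>\<mu>\<in>Poly_Mapping.keys p. Polynomial.smult (Poly_Mapping.lookup p \<mu>)
       (\<Prod>i\<in>Poly_Mapping.keys \<mu>. (Polynomial.monom 1 (e ! i)) ^ Poly_Mapping.lookup \<mu> i))"

definition curve_ideal :: "'k::field itself \<Rightarrow> nat list \<Rightarrow> 'k mpoly set" where
  "curve_ideal K e = {p \<in> carrier (mpoly_ring (length e)). curve_map e p = 0}"

text \<open>
  The list \<open>e = [e\<^sub>0, \<dots>, e\<^sub>r]\<close> has \<open>r + 1\<close> entries, so that the height of its ideal is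
  \<open>r = length e - 1\<close>. The generators are given as a list because repetitions are harmless.
\<close>

definition complete_intersection_seq :: "'k::field itself \<Rightarrow> nat list \<Rightarrow> bool" where
  "complete_intersection_seq K e \<longleftrightarrow>
     e \<noteq> [] \<and> sorted_wrt (<) e \<and> (\<forall>x\<in>set e. 0 < x) \<and>
     (\<exists>gs. length gs = length e - 1 \<and>
           set gs \<subseteq> carrier (mpoly_ring (length e)) \<and>
           curve_ideal K e = Idl\<^bsub>mpoly_ring (length e)\<^esub> (set gs))"

definition shift_seq :: "nat list \<Rightarrow> nat \<Rightarrow> nat list" where
  "shift_seq a j = j # map (\<lambda>x. j + x) a"

text \<open>
  The carrier of \<^const>\<open>mpoly_ring\<close> is closed under the operations, so \<^const>\<open>genideal\<close> is
  the ideal generated in \<open>K[x\<^sub>0, \<dots>, x\<^bsub>m-1\<^esub>]\<close>.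
\<close>

lemma cring_mpoly_ring: "cring (mpoly_ring m :: 'k::field mpoly ring)"
proof -
  let ?C = "{p :: 'k mpoly. \<forall>\<mu>\<in>Poly_Mapping.keys p. Poly_Mapping.keys \<mu> \<subseteq> {..<m}}"
  have add: "p + q \<in> ?C" if "p \<in> ?C" "q \<in> ?C" for p q
    using that Poly_Mapping.keys_add[of p q] by blast
  have mult: "p * q \<in> ?C" if "p \<in> ?C" "q \<in> ?C" for p q
  proof clarify
    fix \<mu> i
    assume "\<mu> \<in> Poly_Mapping.keys (p * q)" "i \<in> Poly_Mapping.keys \<mu>"
    then obtain \<alpha> \<beta> where "\<mu> = \<alpha> + \<beta>" "\<alpha> \<in> Poly_Mapping.keys p" "\<beta> \<in> Poly_Mapping.keys q"
      using keys_mult[of p q] by blast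
    then show "i < m"
      using that \<open>i \<in> Poly_Mapping.keys \<mu>\<close> Poly_Mapping.keys_add[of \<alpha> \<beta>] by blast
  qed
  have neg: "\<exists>q\<in>?C. q + p = 0" if "p \<in> ?C" for p
    using that by (intro bexI[of _ "- p"]) auto
  show ?thesis
  proof (intro cringI abelian_groupI comm_monoidI)
    fix x :: "'k mpoly"
    assume "x \<in> carrier (mpoly_ring m)"
    then show "\<exists>y\<in>carrier (mpoly_ring m).
        y \<oplus>\<^bsub>mpoly_ring m\<^esub> x = \<zero>\<^bsub>mpoly_ring m\<^esub>"
      using neg[of x] by (simp add: mpoly_ring_def)
  next
    fix x y :: "'k mpoly"
    assume "x \<in> carrier (mpoly_ring m)" "y \<in> carrier (mpoly_ring m)"
    then show "x \<oplus>\<^bsub>mpoly_ring m\<^esub> y \<in> carrier (mpoly_ring m)"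
      and "x \<otimes>\<^bsub>mpoly_ring m\<^esub> y \<in> carrier (mpoly_ring m)"
      using add[of x y] mult[of x y] by (simp_all add: mpoly_ring_def)
  qed (simp_all add: mpoly_ring_def algebra_simps)
qed

end

theory Submission
  imports Defs
begin

text \<open>
  Let \<open>n\<close> be the length of \<open>a\<close>, let \<open>e = a + (j)\<close>, and grade the polynomial ring in
  \<open>x\<^sub>0, \<dots>, x\<^sub>n\<close> by the weights \<open>e\<close>. The ideal of \<open>a\<close> is generated by binomials of total degree at
  most some \<open>D\<close>. For \<open>j\<close> large compared with \<open>D\<close>, a polynomial that is homogeneous of weight at
  most \<open>W \<approx> D j\<close> is homogeneous for the total degree as well, so setting \<open>x\<^sub>0 = 1\<close> maps the elements
  of weight at most \<open>W\<close> in the ideal of \<open>e\<close> to the ideal of \<open>a\<close>; conversely the binomials of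
  degree at most \<open>D\<close> lift to elements of weight at most \<open>W\<close>. By graded Nakayama, if the ideal of \<open>e\<close>
  has \<open>n\<close> generators then it has \<open>n\<close> homogeneous ones. Those of weight at most \<open>W\<close> dehomogenize
  to generators of the ideal of \<open>a\<close>, and at least one of the \<open>n\<close> has larger weight, since the
  binomial of \<open>x\<^sub>0\<close> and \<open>x\<^sub>1\<close> does not dehomogenize into the ideal of \<open>a\<close>.
\<close>

section \<open>Homomorphisms out of the polynomial ring\<close>

lemma poly_mapping_eq_sum_single:
  "p = (\<Sum>\<mu>\<in>Poly_Mapping.keys p. Poly_Mapping.single \<mu> (Poly_Mapping.lookup p \<mu>))"
  by (rule poly_mapping_eqI)
     (simp add: lookup_sum lookup_single when_def sum.delta in_keys_iff)

lemma carrier_mpoly_ring_iff: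
  "p \<in> carrier (mpoly_ring m) \<longleftrightarrow> (\<forall>\<mu>\<in>Poly_Mapping.keys p. Poly_Mapping.keys \<mu> \<subseteq> {..<m})"
  by (simp add: mpoly_ring_def)

lemma mpoly_ring_simps [simp]:
  "x \<oplus>\<^bsub>mpoly_ring m\<^esub> y = x + y" "x \<otimes>\<^bsub>mpoly_ring m\<^esub> y = x * y"
  "\<zero>\<^bsub>mpoly_ring m\<^esub> = 0" "\<one>\<^bsub>mpoly_ring m\<^esub> = 1"
  by (simp_all add: mpoly_ring_def)

lemma single_in_carrier: "Poly_Mapping.keys \<mu> \<subseteq> {..<m} \<Longrightarrow> Poly_Mapping.single \<mu> c \<in> carrier (mpoly_ring m)"
  by (simp add: carrier_mpoly_ring_iff)

lemma carrier_mpoly_closed: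
  fixes p q :: "'k::field mpoly"
  shows "0 \<in> carrier (mpoly_ring m :: 'k mpoly ring)" "1 \<in> carrier (mpoly_ring m :: 'k mpoly ring)"
    "p \<in> carrier (mpoly_ring m) \<Longrightarrow> q \<in> carrier (mpoly_ring m) \<Longrightarrow> p + q \<in> carrier (mpoly_ring m)"
    "p \<in> carrier (mpoly_ring m) \<Longrightarrow> q \<in> carrier (mpoly_ring m) \<Longrightarrow> p - q \<in> carrier (mpoly_ring m)"
    "p \<in> carrier (mpoly_ring m) \<Longrightarrow> q \<in> carrier (mpoly_ring m) \<Longrightarrow> p * q \<in> carrier (mpoly_ring m)"
    "p \<in> carrier (mpoly_ring m) \<Longrightarrow> - p \<in> carrier (mpoly_ring m)"
proof -
  interpret R: cring "mpoly_ring m :: 'k mpoly ring" by (rule cring_mpoly_ring)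
  show "0 \<in> carrier (mpoly_ring m :: 'k mpoly ring)" "1 \<in> carrier (mpoly_ring m :: 'k mpoly ring)"
    using R.zero_closed R.one_closed by simp_all
  show add: "p + q \<in> carrier (mpoly_ring m)"
    if "p \<in> carrier (mpoly_ring m)" "q \<in> carrier (mpoly_ring m)" for p q :: "'k mpoly"
    using R.a_closed[OF that] by simp
  show neg: "- p \<in> carrier (mpoly_ring m)" if "p \<in> carrier (mpoly_ring m)" for p :: "'k mpoly"
    using that by (simp add: carrier_mpoly_ring_iff)
  show "p - q \<in> carrier (mpoly_ring m)"
    if "p \<in> carrier (mpoly_ring m)" "q \<in> carrier (mpoly_ring m)"
    using add[OF that(1) neg[OF that(2)]] by simp
  show "p * q \<in> carrier (mpoly_ring m)"
    if "p \<in> carrier (mpoly_ring m)" "q \<in> carrier (mpoly_ring m)"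
    using R.m_closed[OF that] by simp
qed

lemma carrier_mpoly_sum:
  "(\<And>x. x \<in> S \<Longrightarrow> f x \<in> carrier (mpoly_ring m)) \<Longrightarrow> (\<Sum>x\<in>S. f x) \<in> carrier (mpoly_ring m)"
  by (induction S rule: infinite_finite_induct) (simp_all add: carrier_mpoly_closed)

text \<open>The common form of the substitutions below: \<open>\<kappa>\<close> acts on coefficients
  and \<open>\<theta>\<close> on monomials. The curve map, the weight grading, the constant term and
  the dehomogenization are all instances, so additivity and multiplicativity are proved only
  once.\<close>

definition lin_ext :: "('k \<Rightarrow> 'r) \<Rightarrow> ((nat \<Rightarrow>\<^sub>0 nat) \<Rightarrow> 'r) \<Rightarrow> 'k::field mpoly \<Rightarrow> 'r::comm_ring_1" where
  "lin_ext \<kappa> \<theta> p = (\<Sum>\<mu>\<in>Poly_Mapping.keys p. \<kappa> (Poly_Mapping.lookup p \<mu>) * \<theta> \<mu>)"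

locale mpoly_hom =
  fixes \<kappa> :: "'k::field \<Rightarrow> 'r::comm_ring_1" and \<theta> :: "(nat \<Rightarrow>\<^sub>0 nat) \<Rightarrow> 'r"
  assumes scalar_add: "\<kappa> (c + d) = \<kappa> c + \<kappa> d"
    and scalar_mult: "\<kappa> (c * d) = \<kappa> c * \<kappa> d"
    and scalar_one: "\<kappa> 1 = 1"
    and monom_add: "\<theta> (\<mu> + \<nu>) = \<theta> \<mu> * \<theta> \<nu>"
    and monom_zero: "\<theta> 0 = 1"
begin

lemma scalar_zero: "\<kappa> 0 = 0"
  using scalar_add[of 0 0] by simp

text \<open>Cancellation makes the support of \<open>p + q\<close> awkward, so sums are compared
  over a common finite superset; the extra terms vanish because
  \<open>\<kappa> 0 = 0\<close>.\<close>

lemma superset: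
  assumes "finite S" "Poly_Mapping.keys p \<subseteq> S"
  shows "lin_ext \<kappa> \<theta> p = (\<Sum>\<mu>\<in>S. \<kappa> (Poly_Mapping.lookup p \<mu>) * \<theta> \<mu>)"
  unfolding lin_ext_def using assms by (intro sum.mono_neutral_left) (auto simp: in_keys_iff scalar_zero)

lemma single: "lin_ext \<kappa> \<theta> (Poly_Mapping.single \<mu> c) = \<kappa> c * \<theta> \<mu>"
  by (subst superset[of "{\<mu>}"]) (auto simp: scalar_zero)

lemma zero: "lin_ext \<kappa> \<theta> 0 = 0"
  by (simp add: lin_ext_def)

lemma one: "lin_ext \<kappa> \<theta> 1 = 1"
  using single[of 0 1] by (simp add: scalar_one monom_zero)

lemma add: "lin_ext \<kappa> \<theta> (p + q) = lin_ext \<kappa> \<theta> p + lin_ext \<kappa> \<theta> q"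
proof -
  let ?S = "Poly_Mapping.keys p \<union> Poly_Mapping.keys q"
  have "lin_ext \<kappa> \<theta> r = (\<Sum>\<mu>\<in>?S. \<kappa> (Poly_Mapping.lookup r \<mu>) * \<theta> \<mu>)"
    if "r \<in> {p, q, p + q}" for r
    using that keys_add[of p q] by (intro superset) auto
  then show ?thesis
    by (simp add: lookup_add scalar_add distrib_right sum.distrib)
qed

lemma sum: "lin_ext \<kappa> \<theta> (\<Sum>x\<in>S. f x) = (\<Sum>x\<in>S. lin_ext \<kappa> \<theta> (f x))"
  by (induction S rule: infinite_finite_induct) (simp_all add: zero add)

lemma diff: "lin_ext \<kappa> \<theta> (p - q) = lin_ext \<kappa> \<theta> p - lin_ext \<kappa> \<theta> q"
  using add[of "p - q" q] by simp

lemma mult: "lin_ext \<kappa> \<theta> (p * q) = lin_ext \<kappa> \<theta> p * lin_ext \<kappa> \<theta> q"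
proof -
  let ?t = "\<lambda>p \<mu>. Poly_Mapping.single \<mu> (Poly_Mapping.lookup p \<mu>)"
  have "lin_ext \<kappa> \<theta> (p * q) =
      lin_ext \<kappa> \<theta> ((\<Sum>\<mu>\<in>Poly_Mapping.keys p. ?t p \<mu>) * (\<Sum>\<nu>\<in>Poly_Mapping.keys q. ?t q \<nu>))"
    using poly_mapping_eq_sum_single[of p] poly_mapping_eq_sum_single[of q] by simp
  also have "\<dots> = lin_ext \<kappa> \<theta> p * lin_ext \<kappa> \<theta> q"
    by (simp only: sum_product sum mult_single single)
      (simp add: lin_ext_def sum_product scalar_mult monom_add mult_ac)
  finally show ?thesis .
qed

end

section \<open>Weights of monomials, the curve map and the weight grading\<close>

text \<open>The exponent of \<open>t\<close> in the image of a monomial under the curve map. The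
  weights \<open>replicate n 1\<close> give the total degree.\<close>

definition mweight :: "nat list \<Rightarrow> (nat \<Rightarrow>\<^sub>0 nat) \<Rightarrow> nat" where
  "mweight e \<mu> = (\<Sum>i\<in>Poly_Mapping.keys \<mu>. Poly_Mapping.lookup \<mu> i * e ! i)"

lemma mweight_superset:
  assumes "finite S" "Poly_Mapping.keys \<mu> \<subseteq> S"
  shows "mweight e \<mu> = (\<Sum>i\<in>S. Poly_Mapping.lookup \<mu> i * e ! i)"
  unfolding mweight_def using assms by (intro sum.mono_neutral_left) (auto simp: in_keys_iff)

lemma mweight_zero [simp]: "mweight e 0 = 0"
  by (simp add: mweight_def)

lemma mweight_single [simp]: "mweight e (Poly_Mapping.single i k) = k * e ! i"
  by (subst mweight_superset[of "{i}"]) auto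

lemma mweight_add [simp]: "mweight e (\<mu> + \<nu>) = mweight e \<mu> + mweight e \<nu>"
proof -
  let ?S = "Poly_Mapping.keys \<mu> \<union> Poly_Mapping.keys \<nu>"
  have "mweight e \<rho> = (\<Sum>i\<in>?S. Poly_Mapping.lookup \<rho> i * e ! i)" if "\<rho> \<in> {\<mu>, \<nu>, \<mu> + \<nu>}" for \<rho>
    using that keys_add[of \<mu> \<nu>] by (intro mweight_superset) auto
  then show ?thesis
    by (simp add: lookup_add distrib_right sum.distrib)
qed

lemma mweight_eq_0D:
  assumes "mweight e \<mu> = 0" "Poly_Mapping.keys \<mu> \<subseteq> {..<length e}" "\<forall>x\<in>set e. 0 < x"
  shows "\<mu> = 0"
proof (rule ccontr)
  assume "\<mu> \<noteq> 0"
  then obtain i where i: "i \<in> Poly_Mapping.keys \<mu>"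
    using keys_eq_empty by blast
  then have "e ! i > 0" using assms(2,3) by auto
  with i assms(1) show False by (auto simp: mweight_def in_keys_iff)
qed

lemma curve_map_eq_lin_ext:
  "curve_map e = lin_ext (\<lambda>c. [:c:]) (\<lambda>\<mu>. Polynomial.monom 1 (mweight e \<mu>))"
proof
  fix p :: "'k::field mpoly"
  have "(\<Prod>i\<in>S. Polynomial.monom (1 :: 'k) (e ! i) ^ f i) = Polynomial.monom 1 (\<Sum>i\<in>S. f i * e ! i)"
    if "finite S" for S and f :: "nat \<Rightarrow> nat"
    using that by induction (simp_all add: monom_power mult_monom monom_0 mult.commute)
  then show "curve_map e p = lin_ext (\<lambda>c. [:c:]) (\<lambda>\<mu>. Polynomial.monom 1 (mweight e \<mu>)) p"
    by (simp add: curve_map_def lin_ext_def mweight_def)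
qed

interpretation curve_map: mpoly_hom "\<lambda>c. [:c:]" "\<lambda>\<mu>. Polynomial.monom 1 (mweight e \<mu>)"
  for e :: "nat list"
  by unfold_locales (simp_all add: mult_monom one_pCons)

text \<open>Each monomial goes to \<open>t\<close> raised to its weight, so membership in the kernel
  can be tested one weight at a time.\<close>

lemma coeff_curve_map:
  "Polynomial.coeff (curve_map e p) w =
    (\<Sum>\<mu>\<in>{\<mu> \<in> Poly_Mapping.keys p. mweight e \<mu> = w}. Poly_Mapping.lookup p \<mu>)"
  unfolding curve_map_eq_lin_ext lin_ext_def
  by (simp add: coeff_sum smult_monom sum.If_cases Collect_conj_eq)

text \<open>The weight grading: the coefficient of \<open>T\<^sup>w\<close> is the homogeneous component of weight \<open>w\<close>.\<close>

definition grading :: "nat list \<Rightarrow> 'k::field mpoly \<Rightarrow> 'k mpoly poly" where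
  "grading e = lin_ext (\<lambda>c. [:Poly_Mapping.single 0 c:])
     (\<lambda>\<mu>. Polynomial.monom (Poly_Mapping.single \<mu> 1) (mweight e \<mu>))"

interpretation grading: mpoly_hom "\<lambda>c. [:Poly_Mapping.single 0 c:]"
  "\<lambda>\<mu>. Polynomial.monom (Poly_Mapping.single \<mu> 1) (mweight e \<mu>)" for e :: "nat list"
  by unfold_locales (simp_all add: mult_monom mult_single one_pCons single_add monom_0 mult.commute)

abbreviation component :: "nat list \<Rightarrow> nat \<Rightarrow> 'k::field mpoly \<Rightarrow> 'k mpoly" where
  "component e w p \<equiv> Polynomial.coeff (grading e p) w"

lemma component_eq:
  "component e w p =
    (\<Sum>\<mu>\<in>{\<mu> \<in> Poly_Mapping.keys p. mweight e \<mu> = w}. Poly_Mapping.single \<mu> (Poly_Mapping.lookup p \<mu>))"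
  unfolding grading_def lin_ext_def
  by (simp add: coeff_sum smult_monom mult_single sum.If_cases Collect_conj_eq)

lemma lookup_component:
  "Poly_Mapping.lookup (component e w p) \<mu> = (if mweight e \<mu> = w then Poly_Mapping.lookup p \<mu> else 0)"
  unfolding component_eq lookup_sum
  by (simp add: lookup_single when_def sum.delta in_keys_iff)

definition homogeneous :: "nat list \<Rightarrow> nat \<Rightarrow> 'k::field mpoly \<Rightarrow> bool" where
  "homogeneous e w p \<longleftrightarrow> (\<forall>\<mu>\<in>Poly_Mapping.keys p. mweight e \<mu> = w)"

lemma homogeneous_component: "homogeneous e w (component e w p)"
  by (auto simp: homogeneous_def in_keys_iff lookup_component split: if_splits)

lemma component_in_carrier:
  "p \<in> carrier (mpoly_ring m) \<Longrightarrow> component e w p \<in> carrier (mpoly_ring m)"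
  by (auto simp: carrier_mpoly_ring_iff in_keys_iff lookup_component split: if_splits)

lemma grading_homogeneous:
  assumes "homogeneous e w p"
  shows "grading e p = Polynomial.monom p w"
proof (rule poly_eqI, rule poly_mapping_eqI)
  fix v \<mu>
  show "Poly_Mapping.lookup (component e v p) \<mu> =
      Poly_Mapping.lookup (Polynomial.coeff (Polynomial.monom p w) v) \<mu>"
    using assms by (auto simp: lookup_component homogeneous_def in_keys_iff)
qed

text \<open>The grading is multiplicative and sends \<open>q\<close> to the single term
  \<open>q T^d\<close>, so multiplication by \<open>q\<close> shifts components by \<open>d\<close>.
  The case distinction guards the subtraction of natural numbers.\<close>

lemma component_mult_homogeneous:
  assumes "homogeneous e d q"
  shows "component e w (p * q) = (if d \<le> w then component e (w - d) p * q else 0)"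
proof -
  have "grading e (p * q) = Polynomial.monom q d * grading e p"
    using grading.mult[of e p q] grading_homogeneous[OF assms]
    by (simp add: grading_def mult.commute)
  then show ?thesis
    by (simp add: coeff_monom_mult mult.commute)
qed

lemma component_sum: "component e w (\<Sum>x\<in>S. f x) = (\<Sum>x\<in>S. component e w (f x))"
  using grading.sum[of e f S] by (simp add: grading_def coeff_sum)

lemma sum_component: "p = (\<Sum>w\<in>mweight e ` Poly_Mapping.keys p. component e w p)"
  by (rule poly_mapping_eqI) (auto simp: lookup_sum lookup_component sum.delta in_keys_iff)

text \<open>The kernel is a graded ideal: passing to a component keeps one coefficient of the image
  and clears all others.\<close>

lemma curve_map_component_eq_0:
  assumes "curve_map e p = 0"
  shows "curve_map e (component e w p) = 0"
proof (rule poly_eqI)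
  fix v
  have "{\<mu> \<in> Poly_Mapping.keys (component e w p). mweight e \<mu> = v} =
      (if v = w then {\<mu> \<in> Poly_Mapping.keys p. mweight e \<mu> = v} else {})"
    by (auto simp: in_keys_iff lookup_component split: if_splits)
  then have "Polynomial.coeff (curve_map e (component e w p)) v =
      (if v = w then Polynomial.coeff (curve_map e p) v else 0)"
    by (auto simp: coeff_curve_map lookup_component intro!: sum.cong)
  with assms show "Polynomial.coeff (curve_map e (component e w p)) v = Polynomial.coeff 0 v"
    by simp
qed

section \<open>Ideals of the polynomial ring\<close>

lemma ideal_curve_ideal:
  "ideal (curve_ideal TYPE('k::field) e) (mpoly_ring (length e) :: 'k mpoly ring)"
proof -
  interpret R: cring "mpoly_ring (length e) :: 'k mpoly ring" by (rule cring_mpoly_ring)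
  note hom = curve_map.add curve_map.diff curve_map.mult curve_map.zero curve_map.one
  have "subgroup (curve_ideal TYPE('k) e) (add_monoid (mpoly_ring (length e)))"
  proof (rule R.add.subgroupI)
    fix p assume p: "p \<in> curve_ideal TYPE('k) e"
    then have "\<ominus>\<^bsub>mpoly_ring (length e)\<^esub> p = - p"
      using carrier_mpoly_closed(6)[of p "length e"]
      by (intro R.minus_equality) (auto simp: curve_ideal_def)
    moreover have "curve_map e (- p) = 0"
      using p curve_map.diff[of e 0 p] by (simp add: curve_ideal_def curve_map_eq_lin_ext hom)
    ultimately show "\<ominus>\<^bsub>mpoly_ring (length e)\<^esub> p \<in> curve_ideal TYPE('k) e"
      using p by (simp add: curve_ideal_def carrier_mpoly_closed)
  qed (auto simp: curve_ideal_def curve_map_eq_lin_ext hom carrier_mpoly_closed)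
  then show ?thesis
    by (intro idealI R.ring_axioms)
      (auto simp: curve_ideal_def curve_map_eq_lin_ext hom carrier_mpoly_closed)
qed

text \<open>The combinations form an ideal containing \<open>G\<close>, and each of them lies in the
  generated ideal. This yields explicit coefficients, to which gradings and substitutions can be
  applied.\<close>

lemma genideal_mpoly_iff:
  assumes "finite G" "G \<subseteq> carrier (mpoly_ring m :: 'k::field mpoly ring)"
  shows "p \<in> Idl\<^bsub>mpoly_ring m\<^esub> G \<longleftrightarrow>
    (\<exists>c. (\<forall>g\<in>G. c g \<in> carrier (mpoly_ring m)) \<and> p = (\<Sum>g\<in>G. c g * g))"
proof -
  interpret R: cring "mpoly_ring m :: 'k mpoly ring" by (rule cring_mpoly_ring)
  let ?C = "carrier (mpoly_ring m :: 'k mpoly ring)"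
  define J where "J = {p. \<exists>c. (\<forall>g\<in>G. c g \<in> ?C) \<and> p = (\<Sum>g\<in>G. c g * g)}"
  have JC: "J \<subseteq> ?C"
    using assms(2) by (auto simp: J_def intro!: carrier_mpoly_sum carrier_mpoly_closed)
  have J_mult: "x * p \<in> J" if p: "p \<in> J" and x: "x \<in> ?C" for p x
  proof -
    obtain c where c: "(\<forall>g\<in>G. c g \<in> ?C) \<and> p = (\<Sum>g\<in>G. c g * g)"
      using p unfolding J_def mem_Collect_eq ..
    then have "x * p = (\<Sum>g\<in>G. (x * c g) * g)" "\<forall>g\<in>G. x * c g \<in> ?C"
      using x by (simp_all add: sum_distrib_left mult.assoc carrier_mpoly_closed)
    then show ?thesis unfolding J_def mem_Collect_eq by (intro exI[of _ "\<lambda>g. x * c g"] conjI)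
  qed
  have J_add: "p + q \<in> J" if p: "p \<in> J" and q: "q \<in> J" for p q
  proof -
    obtain c where c: "(\<forall>g\<in>G. c g \<in> ?C) \<and> p = (\<Sum>g\<in>G. c g * g)"
      using p unfolding J_def mem_Collect_eq ..
    obtain d where d: "(\<forall>g\<in>G. d g \<in> ?C) \<and> q = (\<Sum>g\<in>G. d g * g)"
      using q unfolding J_def mem_Collect_eq ..
    from c d have "p + q = (\<Sum>g\<in>G. (c g + d g) * g)" "\<forall>g\<in>G. c g + d g \<in> ?C"
      by (simp_all add: sum.distrib distrib_right carrier_mpoly_closed)
    then show ?thesis unfolding J_def mem_Collect_eq by (intro exI[of _ "\<lambda>g. c g + d g"] conjI)
  qed
  have zero: "0 \<in> J"
    unfolding J_def mem_Collect_eq by (intro exI[of _ "\<lambda>_. 0"]) (simp add: carrier_mpoly_closed)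
  have "subgroup J (add_monoid (mpoly_ring m))"
  proof (rule R.add.subgroupI)
    fix p assume p: "p \<in> J"
    then have "\<ominus>\<^bsub>mpoly_ring m\<^esub> p = - p"
      using carrier_mpoly_closed(6)[of p m] JC by (intro R.minus_equality) auto
    moreover have "(- 1) * p \<in> J"
      using p by (intro J_mult) (auto intro: carrier_mpoly_closed)
    ultimately show "\<ominus>\<^bsub>mpoly_ring m\<^esub> p \<in> J"
      by simp
  qed (use JC J_add zero in auto)
  then have ideal: "ideal J (mpoly_ring m)"
    using J_mult by (intro idealI R.ring_axioms) (auto simp: mult.commute)
  have "G \<subseteq> J"
  proof
    fix g assume "g \<in> G"
    then have "g = (\<Sum>h\<in>G. (if h = g then 1 else 0) * h)"
      using assms(1) by (simp add: sum.delta if_distrib[of "\<lambda>x. x * _"] cong: if_cong)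
    then show "g \<in> J"
      unfolding J_def mem_Collect_eq
      by (intro exI[of _ "\<lambda>h. if h = g then 1 else 0"]) (simp add: carrier_mpoly_closed)
  qed
  with ideal have "Idl\<^bsub>mpoly_ring m\<^esub> G \<subseteq> J" by (rule R.genideal_minimal)
  moreover have "J \<subseteq> Idl\<^bsub>mpoly_ring m\<^esub> G"
  proof
    fix p assume "p \<in> J"
    then obtain c where c: "(\<forall>g\<in>G. c g \<in> ?C) \<and> p = (\<Sum>g\<in>G. c g * g)"
      unfolding J_def mem_Collect_eq ..
    interpret I: ideal "Idl\<^bsub>mpoly_ring m\<^esub> G" "mpoly_ring m :: 'k mpoly ring"
      using assms(2) by (rule R.genideal_ideal)
    have "(\<Sum>g\<in>S. c g * g) \<in> Idl\<^bsub>mpoly_ring m\<^esub> G" if "finite S" "S \<subseteq> G" for S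
      using that
    proof induction
      case empty
      then show ?case using I.zero_closed by simp
    next
      case (insert g S)
      then have "c g * g \<in> Idl\<^bsub>mpoly_ring m\<^esub> G"
        using I.I_l_closed[of g "c g"] R.genideal_self[OF assms(2)] c by auto
      then show ?case using insert I.a_closed[of "c g * g" "\<Sum>g\<in>S. c g * g"] by simp
    qed
    then show "p \<in> Idl\<^bsub>mpoly_ring m\<^esub> G" using c assms(1) by simp
  qed
  ultimately show ?thesis by (auto simp: J_def)
qed

lemma ideal_mpoly_closed:
  fixes J :: "'k::field mpoly set"
  assumes "ideal J (mpoly_ring m)"
  shows "J \<subseteq> carrier (mpoly_ring m)" "0 \<in> J"
    "p \<in> J \<Longrightarrow> q \<in> J \<Longrightarrow> p + q \<in> J"
    "p \<in> J \<Longrightarrow> c \<in> carrier (mpoly_ring m) \<Longrightarrow> c * p \<in> J"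
    "p \<in> J \<Longrightarrow> - p \<in> J"
    "p \<in> J \<Longrightarrow> q \<in> J \<Longrightarrow> p - q \<in> J"
proof -
  interpret J: ideal J "mpoly_ring m" by fact
  show "J \<subseteq> carrier (mpoly_ring m)" by (rule J.a_subset)
  show "0 \<in> J" using additive_subgroup.zero_closed[OF ideal.axioms(1)[OF assms]] by simp
  show add: "p + q \<in> J" if "p \<in> J" "q \<in> J" for p q using additive_subgroup.a_closed[OF ideal.axioms(1)[OF assms] that] by simp
  show mult: "c * p \<in> J" if "p \<in> J" "c \<in> carrier (mpoly_ring m)" for c p
    using J.I_l_closed[OF that] by simp
  show neg: "- p \<in> J" if "p \<in> J" for p
    using mult[OF that, of "- 1"] by (simp add: carrier_mpoly_closed)
  show "p - q \<in> J" if "p \<in> J" "q \<in> J" using add[OF that(1) neg[OF that(2)]] by simp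
qed

lemma ideal_mpoly_sum:
  assumes "ideal J (mpoly_ring m)" "\<And>x. x \<in> S \<Longrightarrow> f x \<in> J"
  shows "(\<Sum>x\<in>S. f x) \<in> J"
  using assms(2)
  by (induction S rule: infinite_finite_induct) (simp_all add: ideal_mpoly_closed[OF assms(1)])

section \<open>Graded Nakayama\<close>

text \<open>A rank argument: the identity matrix on \<open>G\<close> factors as \<open>B\<close>
  times \<open>A\<close>, so the rows of \<open>A\<close>, at most \<open>card F\<close> many, span
  \<open>card G\<close> independent unit vectors.\<close>

lemma card_le_if_factorizes:
  fixes B :: "'a \<Rightarrow> 'b \<Rightarrow> 'k::field"
  assumes "finite G" "finite F"
    and id: "\<And>g h. g \<in> G \<Longrightarrow> h \<in> G \<Longrightarrow> (\<Sum>f\<in>F. B g f * A f h) = (if h = g then 1 else 0)"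
  shows "card G \<le> card F"
proof -
  let ?s = "\<lambda>(c :: 'k) (p :: 'a \<Rightarrow>\<^sub>0 'k). Poly_Mapping.map ((*) c) p"
  have ls: "Poly_Mapping.lookup (?s c p) k = c * Poly_Mapping.lookup p k" for c p k
    by (simp add: map.rep_eq when_def)
  interpret V: vector_space ?s
    by unfold_locales (auto intro!: poly_mapping_eqI simp: ls lookup_add algebra_simps)
  \<comment> \<open>\<open>r f\<close> is the row of \<open>A\<close> at \<open>f\<close>, cut down
    to the columns in \<open>G\<close>; the hypothesis \<open>id\<close> then writes the unit vector
    \<open>u g\<close> as a combination of rows with coefficients \<open>B g f\<close>.\<close>
  define r where "r f = (\<Sum>h\<in>G. Poly_Mapping.single h (A f h))" for f
  define u where "u g = Poly_Mapping.single g (1 :: 'k)" for g :: 'a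
  have u: "u g = (\<Sum>f\<in>F. ?s (B g f) (r f))" if "g \<in> G" for g
  proof (rule poly_mapping_eqI)
    fix k
    show "Poly_Mapping.lookup (u g) k = Poly_Mapping.lookup (\<Sum>f\<in>F. ?s (B g f) (r f)) k"
      using assms(1) id[OF that] that
      by (cases "k \<in> G") (auto simp: u_def r_def lookup_sum ls lookup_single when_def)
  qed
  have "u ` G \<subseteq> V.span (r ` F)"
  proof (rule image_subsetI)
    fix g assume "g \<in> G"
    show "u g \<in> V.span (r ` F)"
      unfolding u[OF \<open>g \<in> G\<close>] by (rule V.span_sum, rule V.span_scale, rule V.span_base) simp
  qed
  moreover have "V.independent (u ` G)"
    unfolding V.independent_explicit_finite_subsets
  proof (intro allI impI ballI)
    fix S c v
    assume S: "S \<subseteq> u ` G" "finite S" "(\<Sum>v\<in>S. ?s (c v) v) = 0" and v: "v \<in> S"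
    then obtain g where g: "v = u g" by auto
    have "Poly_Mapping.lookup x g = (if x = v then 1 else 0)" if "x \<in> S" for x
      using S(1) that by (auto simp: g u_def lookup_single when_def)
    then have "Poly_Mapping.lookup (\<Sum>v\<in>S. ?s (c v) v) g = (\<Sum>x\<in>S. if x = v then c x else 0)"
      unfolding lookup_sum ls by (intro sum.cong) auto
    then show "c v = 0"
      using S v by simp
  qed
  ultimately have "card (u ` G) \<le> card (r ` F)"
    using V.independent_span_bound[of "r ` F" "u ` G"] assms(2) by auto
  also have "\<dots> \<le> card F" using assms(2) by (rule card_image_le)
  also have "card (u ` G) = card G"
    by (intro card_image inj_onI) (metis u_def lookup_single_eq lookup_single_not_eq zero_neq_one)
  finally show ?thesis .
qed

text \<open>Evaluation at the origin, multiplicative because a sum of two exponent vectors is zero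
  only if both are. It reduces matrices of polynomials to matrices over the field.\<close>

interpretation const_term: mpoly_hom "\<lambda>c. c" "\<lambda>\<mu>. if \<mu> = 0 then 1 else 0"
proof
  show "(if \<mu> + \<nu> = 0 then 1 else 0) = (if \<mu> = 0 then 1 else 0) * (if \<nu> = 0 then 1 else (0 :: 'k::field))"
    for \<mu> \<nu> :: "nat \<Rightarrow>\<^sub>0 nat"
    by (auto simp: poly_mapping_eq_iff fun_eq_iff lookup_add)
qed simp_all

lemma lin_ext_const_term: "lin_ext (\<lambda>c. c) (\<lambda>\<mu>. if \<mu> = 0 then 1 else 0) p = Poly_Mapping.lookup p 0"
proof -
  have "lin_ext (\<lambda>c. c) (\<lambda>\<mu>. if \<mu> = 0 then 1 else 0) p =
      (\<Sum>\<mu>\<in>Poly_Mapping.keys p. if \<mu> = 0 then Poly_Mapping.lookup p \<mu> else 0)"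
    unfolding lin_ext_def by (intro sum.cong) auto
  then show ?thesis by (simp add: in_keys_iff)
qed

lemma lookup_mult_zero:
  fixes p q :: "'k::field mpoly"
  shows "Poly_Mapping.lookup (p * q) 0 = Poly_Mapping.lookup p 0 * Poly_Mapping.lookup q 0"
  using const_term.mult[of p q] by (simp add: lin_ext_const_term)

text \<open>Take a homogeneous generating set \<open>G\<close> of least cardinality. Relations among
  its elements have coefficients without constant term. Writing \<open>G\<close> through
  \<open>F\<close> by \<open>B\<close> and \<open>F\<close> through \<open>G\<close> by
  \<open>A\<close>, the product of \<open>B\<close> and \<open>A\<close> is therefore the identity
  modulo the variables, and comparing ranks gives the bound.\<close>

lemma homogeneous_generators:
  fixes F :: "'k::field mpoly set"
  assumes pos: "\<forall>x\<in>set e. 0 < x"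
    and F: "finite F" "F \<subseteq> carrier (mpoly_ring (length e))"
    and graded: "\<And>p w. p \<in> Idl\<^bsub>mpoly_ring (length e)\<^esub> F \<Longrightarrow>
      component e w p \<in> Idl\<^bsub>mpoly_ring (length e)\<^esub> F"
  obtains G d where "finite G" "card G \<le> card F" "G \<subseteq> carrier (mpoly_ring (length e))"
    "Idl\<^bsub>mpoly_ring (length e)\<^esub> G = Idl\<^bsub>mpoly_ring (length e)\<^esub> F"
    "\<And>g. g \<in> G \<Longrightarrow> homogeneous e (d g) g"
proof -
  define R where "R = (mpoly_ring (length e) :: 'k mpoly ring)"
  interpret R: cring R unfolding R_def by (rule cring_mpoly_ring)
  define I where "I = Idl\<^bsub>R\<^esub> F"
  have FC: "F \<subseteq> carrier R" using F(2) by (simp add: R_def)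
  have I: "ideal I R" unfolding I_def using FC by (rule R.genideal_ideal)
  note I_closed = ideal_mpoly_closed[OF I[unfolded R_def], folded R_def]
  have FI: "F \<subseteq> I" unfolding I_def using FC by (rule R.genideal_self)
  define P where "P G \<longleftrightarrow> finite G \<and> G \<subseteq> I \<and> (\<forall>g\<in>G. \<exists>w. homogeneous e w g) \<and> Idl\<^bsub>R\<^esub> G = I" for G
  \<comment> \<open>The homogeneous components of the given generators: a first homogeneous
    generating set, which shows that a minimal one exists.\<close>
  define G0 where "G0 = (\<Union>f\<in>F. (\<lambda>w. component e w f) ` mweight e ` Poly_Mapping.keys f)"
  have "P G0"
    unfolding P_def
  proof (intro conjI)
    show "finite G0" using F(1) by (auto simp: G0_def)
    show GI: "G0 \<subseteq> I" using FI graded by (auto simp: G0_def I_def R_def)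
    then have GC: "G0 \<subseteq> carrier R" using I_closed(1) by blast
    show "\<forall>g\<in>G0. \<exists>w. homogeneous e w g" using homogeneous_component by (fastforce simp: G0_def)
    show "Idl\<^bsub>R\<^esub> G0 = I"
    proof
      show "Idl\<^bsub>R\<^esub> G0 \<subseteq> I" using I GI by (rule R.genideal_minimal)
      have id: "ideal (Idl\<^bsub>R\<^esub> G0) R" using GC by (rule R.genideal_ideal)
      have "f \<in> Idl\<^bsub>R\<^esub> G0" if f: "f \<in> F" for f
      proof -
        have "component e w f \<in> Idl\<^bsub>R\<^esub> G0" if "w \<in> mweight e ` Poly_Mapping.keys f" for w
          using R.genideal_self[OF GC] that f by (auto simp: G0_def)
        then have "(\<Sum>w\<in>mweight e ` Poly_Mapping.keys f. component e w f) \<in> Idl\<^bsub>R\<^esub> G0"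
          using ideal_mpoly_sum id unfolding R_def by blast
        then show ?thesis by (simp only: sum_component[symmetric])
      qed
      then show "I \<subseteq> Idl\<^bsub>R\<^esub> G0" unfolding I_def by (intro R.genideal_minimal id) auto
    qed
  qed
  then obtain G where G: "P G" and G_min: "\<And>H. P H \<Longrightarrow> card G \<le> card H"
    using ex_has_least_nat[of P G0 card] by blast
  have fin: "finite G" and GI: "G \<subseteq> I" and Idl: "Idl\<^bsub>R\<^esub> G = I" using G by (auto simp: P_def)
  have GC: "G \<subseteq> carrier R" using GI I_closed(1) by blast
  obtain d where d: "\<And>g. g \<in> G \<Longrightarrow> homogeneous e (d g) g"
    using G unfolding P_def by metis
  \<comment> \<open>A relation with a nonzero constant term at \<open>g0\<close> would, in weight \<open>d g0\<close>, express \<open>g0\<close> through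
    the other generators, against the minimality of \<open>G\<close>.\<close>
  have indep: "Poly_Mapping.lookup (p g0) 0 = 0"
    if p: "\<forall>g\<in>G. p g \<in> carrier R" and rel: "(\<Sum>g\<in>G. p g * g) = 0" and g0: "g0 \<in> G" for p g0
  proof (rule ccontr)
    define c where "c = Poly_Mapping.lookup (p g0) 0"
    assume "Poly_Mapping.lookup (p g0) 0 \<noteq> 0"
    then have c: "c \<noteq> 0" by (simp add: c_def)
    \<comment> \<open>The part of the coefficient of \<open>g\<close> that contributes to weight
      \<open>d g0\<close> of the relation. For \<open>g0\<close> itself it is the component of
      weight 0.\<close>
    define q where "q g = (if d g \<le> d g0 then component e (d g0 - d g) (p g) else 0)" for g
    have q: "q g \<in> carrier R" if "g \<in> G" for g
      using p that by (auto simp: q_def R_def intro: component_in_carrier carrier_mpoly_closed)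
    have "(\<Sum>g\<in>G. q g * g) = component e (d g0) (\<Sum>g\<in>G. p g * g)"
      unfolding component_sum
      by (intro sum.cong) (simp_all add: component_mult_homogeneous[OF d] q_def)
    also have "\<dots> = 0" by (simp add: rel grading_def grading.zero)
    finally have sum0: "q g0 * g0 + (\<Sum>g\<in>G - {g0}. q g * g) = 0"
      using fin g0 by (simp add: sum.remove)
    \<comment> \<open>All weights of variables are positive, so only the constant monomial has
      weight 0. The coefficient of \<open>g0\<close> is thus the nonzero scalar \<open>c\<close>,
      which can be inverted.\<close>
    have "component e 0 (p g0) = Poly_Mapping.single 0 c"
    proof (rule poly_mapping_eqI)
      fix \<mu>
      have "\<mu> = 0" if "mweight e \<mu> = 0" "Poly_Mapping.lookup (p g0) \<mu> \<noteq> 0"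
        using that p g0 by (intro mweight_eq_0D[OF that(1) _ pos])
          (auto simp: R_def carrier_mpoly_ring_iff in_keys_iff)
      then show "Poly_Mapping.lookup (component e 0 (p g0)) \<mu> = Poly_Mapping.lookup (Poly_Mapping.single 0 c) \<mu>"
        by (auto simp: lookup_component lookup_single when_def c_def)
    qed
    then have "q g0 = Poly_Mapping.single 0 c" by (simp add: q_def)
    then have "Poly_Mapping.single 0 (- inverse c) * (q g0 * g0) = - g0"
      using c by (simp add: mult.assoc[symmetric] mult_single single_uminus)
    moreover have "q g0 * g0 = - (\<Sum>g\<in>G - {g0}. q g * g)"
      using sum0 by (simp add: eq_neg_iff_add_eq_0)
    ultimately have "g0 = (\<Sum>g\<in>G - {g0}. (Poly_Mapping.single 0 (- inverse c) * q g) * g)"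
      by (simp add: sum_distrib_left mult.assoc)
    moreover have "\<forall>g\<in>G - {g0}. Poly_Mapping.single 0 (- inverse c) * q g \<in> carrier R"
      using q by (auto simp: R_def intro!: carrier_mpoly_closed single_in_carrier)
    ultimately have "\<exists>c. (\<forall>g\<in>G - {g0}. c g \<in> carrier R) \<and> g0 = (\<Sum>g\<in>G - {g0}. c g * g)"
      by (intro exI[of _ "\<lambda>g. Poly_Mapping.single 0 (- inverse c) * q g"] conjI)
    moreover have C': "G - {g0} \<subseteq> carrier R" using GC by blast
    ultimately have g0_in: "g0 \<in> Idl\<^bsub>R\<^esub> (G - {g0})"
      using genideal_mpoly_iff[of "G - {g0}" "length e" g0] fin unfolding R_def by simp
    have "Idl\<^bsub>R\<^esub> (G - {g0}) \<subseteq> I" using I GI by (intro R.genideal_minimal) auto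
    moreover have "Idl\<^bsub>R\<^esub> G \<subseteq> Idl\<^bsub>R\<^esub> (G - {g0})"
      using R.genideal_self[OF C'] g0_in by (intro R.genideal_minimal R.genideal_ideal C') auto
    ultimately have "P (G - {g0})" using G Idl unfolding P_def by auto
    from G_min[OF this] fin g0 show False
      by (metis card_Diff1_less not_le)
  qed
  have "\<exists>b. (\<forall>f\<in>F. b f \<in> carrier R) \<and> g = (\<Sum>f\<in>F. b f * f)" if "g \<in> G" for g
    by (rule iffD1[OF genideal_mpoly_iff[OF F], folded R_def]) (use GI that in \<open>auto simp: I_def\<close>)
  then obtain B where B: "\<forall>g\<in>G. (\<forall>f\<in>F. B g f \<in> carrier R) \<and> g = (\<Sum>f\<in>F. B g f * f)"
    using bchoice[of G "\<lambda>g b. (\<forall>f\<in>F. b f \<in> carrier R) \<and> g = (\<Sum>f\<in>F. b f * f)"] by blast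
  have "\<exists>a. (\<forall>h\<in>G. a h \<in> carrier R) \<and> f = (\<Sum>h\<in>G. a h * h)" if "f \<in> F" for f
    by (rule iffD1[OF genideal_mpoly_iff[OF fin GC[unfolded R_def]], folded R_def])
      (use FI Idl that in auto)
  then obtain A where A: "\<forall>f\<in>F. (\<forall>h\<in>G. A f h \<in> carrier R) \<and> f = (\<Sum>h\<in>G. A f h * h)"
    using bchoice[of F "\<lambda>f a. (\<forall>h\<in>G. a h \<in> carrier R) \<and> f = (\<Sum>h\<in>G. a h * h)"] by blast
  have "card G \<le> card F"
  proof (rule card_le_if_factorizes[OF fin F(1)])
    fix g h assume g: "g \<in> G" and h: "h \<in> G"
    \<comment> \<open>The row at \<open>g\<close> of the product of \<open>B\<close> and
      \<open>A\<close> minus the identity. It is a relation on \<open>G\<close>, since substituting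
      \<open>A\<close> into the expression of \<open>g\<close> through \<open>F\<close> gives back
      \<open>g\<close>.\<close>
    define p where "p h = (\<Sum>f\<in>F. B g f * A f h) - (if h = g then 1 else 0)" for h
    have "\<forall>h\<in>G. p h \<in> carrier R"
      using B A g by (auto simp: p_def R_def intro!: carrier_mpoly_closed carrier_mpoly_sum)
    moreover have "(\<Sum>h\<in>G. p h * h) = 0"
    proof -
      have "(\<Sum>h\<in>G. (\<Sum>f\<in>F. B g f * A f h) * h) = (\<Sum>f\<in>F. B g f * (\<Sum>h\<in>G. A f h * h))"
        by (simp add: sum_distrib_left sum_distrib_right mult.assoc sum.swap[of _ F])
      also have "\<dots> = (\<Sum>f\<in>F. B g f * f)" using A by (intro sum.cong refl) metis
      also have "\<dots> = g" using bspec[OF B g, THEN conjunct2] by (rule sym)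
      finally show ?thesis
        using fin g
        by (simp add: p_def left_diff_distrib sum_subtractf if_distrib[of "\<lambda>x. x * _"] cong: if_cong)
    qed
    ultimately have "Poly_Mapping.lookup (p h) 0 = 0" using h by (rule indep)
    then show "(\<Sum>f\<in>F. Poly_Mapping.lookup (B g f) 0 * Poly_Mapping.lookup (A f h) 0) =
        (if h = g then 1 else 0)"
      by (auto simp: p_def lookup_minus lookup_sum lookup_mult_zero split: if_splits)
  qed
  with fin GC Idl d show thesis
    by (intro that[of G d]) (auto simp: R_def I_def)
qed

section \<open>Binomial generators of bounded degree\<close>

lemma poly_mapping_split:
  fixes u :: "nat \<Rightarrow>\<^sub>0 nat"
  assumes "k \<le> Poly_Mapping.lookup u i"
  obtains v where "u = Poly_Mapping.single i k + v" "Poly_Mapping.keys v \<subseteq> Poly_Mapping.keys u"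
proof
  show "u = Poly_Mapping.single i k + (u - Poly_Mapping.single i k)"
    using assms by (intro poly_mapping_eqI) (auto simp: lookup_add lookup_minus lookup_single when_def)
  show "Poly_Mapping.keys (u - Poly_Mapping.single i k) \<subseteq> Poly_Mapping.keys u"
    by (auto simp: in_keys_iff lookup_minus)
qed

lemma mweight_mono:
  assumes "\<And>i. i \<in> Poly_Mapping.keys u \<Longrightarrow> e ! i \<le> c * e' ! i"
  shows "mweight e u \<le> c * mweight e' u"
  unfolding mweight_def sum_distrib_left
proof (rule sum_mono)
  fix i assume "i \<in> Poly_Mapping.keys u"
  from mult_le_mono2[OF assms[OF this], of "Poly_Mapping.lookup u i"]
  show "Poly_Mapping.lookup u i * e ! i \<le> c * (Poly_Mapping.lookup u i * e' ! i)"
    by (simp add: mult_ac)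
qed

abbreviation mdegree :: "nat \<Rightarrow> (nat \<Rightarrow>\<^sub>0 nat) \<Rightarrow> nat" where
  "mdegree n \<equiv> mweight (replicate n 1)"

lemma binomial_in_curve_ideal:
  assumes "Poly_Mapping.keys u \<subseteq> {..<length e}" "Poly_Mapping.keys v \<subseteq> {..<length e}"
    and "mweight e u = mweight e v"
  shows "Poly_Mapping.single u 1 - Poly_Mapping.single v 1 \<in> curve_ideal TYPE('k::field) e"
  using assms
  by (simp add: curve_ideal_def curve_map_eq_lin_ext curve_map.diff curve_map.single
      carrier_mpoly_closed single_in_carrier)

text \<open>Induction on the number of monomials. In a kernel element the coefficients of each
  weight sum to zero, so every monomial has a partner of equal weight, and a multiple of their
  binomial cancels it.\<close>

lemma curve_ideal_subset_if_binomials: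
  fixes J :: "'k::field mpoly set"
  assumes J: "ideal J (mpoly_ring (length e))"
    and bin: "\<And>u v. Poly_Mapping.keys u \<subseteq> {..<length e} \<Longrightarrow> Poly_Mapping.keys v \<subseteq> {..<length e} \<Longrightarrow>
      mweight e u = mweight e v \<Longrightarrow> Poly_Mapping.single u 1 - Poly_Mapping.single v 1 \<in> J"
  shows "curve_ideal TYPE('k) e \<subseteq> J"
proof
  fix f :: "'k mpoly"
  note J_closed = ideal_mpoly_closed[OF J]
  note I_closed = ideal_mpoly_closed[OF ideal_curve_ideal]
  assume "f \<in> curve_ideal TYPE('k) e"
  then show "f \<in> J"
  proof (induction "card (Poly_Mapping.keys f)" arbitrary: f rule: less_induct)
    case less
    show ?case
    proof (cases "f = 0")
      case True
      then show ?thesis using J_closed by simp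
    next
      case False
      then obtain \<mu> where \<mu>: "\<mu> \<in> Poly_Mapping.keys f" using keys_eq_empty by blast
      let ?S = "{\<nu> \<in> Poly_Mapping.keys f. mweight e \<nu> = mweight e \<mu>}"
      have "(\<Sum>\<nu>\<in>?S. Poly_Mapping.lookup f \<nu>) = 0"
        using less.prems coeff_curve_map[of e f "mweight e \<mu>"] by (simp add: curve_ideal_def)
      then have "?S \<noteq> {\<mu>}" using \<mu> by (auto simp: in_keys_iff)
      then obtain \<nu> where \<nu>: "\<nu> \<in> Poly_Mapping.keys f" "mweight e \<nu> = mweight e \<mu>" "\<nu> \<noteq> \<mu>"
        using \<mu> by auto
      define c where "c = Poly_Mapping.lookup f \<mu>"
      define b where "b = Poly_Mapping.single \<mu> (1 :: 'k) - Poly_Mapping.single \<nu> 1"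
      have keys: "Poly_Mapping.keys \<mu> \<subseteq> {..<length e}" "Poly_Mapping.keys \<nu> \<subseteq> {..<length e}"
        using less.prems \<mu> \<nu>(1) by (auto simp: curve_ideal_def carrier_mpoly_ring_iff)
      have bJ: "b \<in> J" unfolding b_def using keys \<nu>(2) by (intro bin) auto
      have bI: "b \<in> curve_ideal TYPE('k) e"
        unfolding b_def using keys \<nu>(2) by (intro binomial_in_curve_ideal) auto
      have cC: "Poly_Mapping.single 0 c \<in> carrier (mpoly_ring (length e) :: 'k mpoly ring)"
        by (simp add: single_in_carrier)
      define f' where "f' = f - Poly_Mapping.single 0 c * b"
      have f': "f' = f - Poly_Mapping.single \<mu> c + Poly_Mapping.single \<nu> c"
        by (simp add: f'_def b_def right_diff_distrib mult_single)
      \<comment> \<open>Only the coefficient at \<open>\<nu>\<close> changes besides the one at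
        \<open>\<mu>\<close>, and \<open>\<nu>\<close> already occurs in \<open>f\<close>, so no new
        monomial appears.\<close>
      have "Poly_Mapping.keys f' \<subseteq> Poly_Mapping.keys f - {\<mu>}"
        using \<nu> by (auto simp: f' in_keys_iff lookup_add lookup_minus lookup_single when_def c_def
            split: if_splits)
      then have "card (Poly_Mapping.keys f') < card (Poly_Mapping.keys f)"
        using \<mu> by (intro psubset_card_mono) auto
      moreover have "f' \<in> curve_ideal TYPE('k) e"
        unfolding f'_def using less.prems bI cC by (intro I_closed)
      ultimately have "f' \<in> J" by (rule less.hyps)
      moreover have "f = f' + Poly_Mapping.single 0 c * b" by (simp add: f'_def)
      ultimately show ?thesis using bJ cC J_closed by metis
    qed
  qed
qed

text \<open>
  Monomials of large weight are congruent modulo \<open>J\<close> to multiples of \<open>x\<^sub>0\<close>, so that the common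
  factor \<open>x\<^sub>0\<close> can be cancelled and only finitely many binomials matter.
\<close>

lemma curve_ideal_subset_if_small_binomials:
  fixes J :: "'k::field mpoly set" and a :: "nat list"
  assumes J: "ideal J (mpoly_ring (length a))"
    and a: "a \<noteq> []" "\<forall>x\<in>set a. 0 < x \<and> x \<le> M"
    and bin: "\<And>u v. Poly_Mapping.keys u \<subseteq> {..<length a} \<Longrightarrow> Poly_Mapping.keys v \<subseteq> {..<length a} \<Longrightarrow>
      mweight a u = mweight a v \<Longrightarrow> mdegree (length a) u \<le> length a * M * M \<Longrightarrow>
      mdegree (length a) v \<le> length a * M * M \<Longrightarrow> Poly_Mapping.single u 1 - Poly_Mapping.single v 1 \<in> J"
  shows "curve_ideal TYPE('k) a \<subseteq> J"
proof (rule curve_ideal_subset_if_binomials[OF J])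
  define n where "n = length a"
  note J_closed = ideal_mpoly_closed[OF J]
  \<comment> \<open>Congruence of monomials modulo \<open>J\<close>, compatible with multiplication
    by a monomial.\<close>
  let ?E = "\<lambda>u v. Poly_Mapping.single u 1 - Poly_Mapping.single v 1 \<in> J"
  have ai: "0 < a ! i" "a ! i \<le> M" if "i < n" for i
    using that a(2) by (auto simp: n_def)
  have n: "0 < n" using a(1) by (simp add: n_def)
  have M: "0 < M" using ai[OF n] by simp
  have E_trans: "?E u w" if "?E u v" "?E v w" for u v w
    using J_closed(3)[OF that] by simp
  have E_sym: "?E v u" if "?E u v" for u v
    using J_closed(5)[OF that] by simp
  have E_add: "?E (w + u) (w + v)" if "?E u v" "Poly_Mapping.keys w \<subseteq> {..<n}" for u v w
    using J_closed(4)[OF that(1), of "Poly_Mapping.single w 1"] that(2)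
    by (simp add: right_diff_distrib mult_single single_in_carrier n_def)
  have factor: "\<exists>u'. Poly_Mapping.keys u' \<subseteq> {..<n} \<and> ?E u (Poly_Mapping.single 0 1 + u') \<and>
      mweight a u = a ! 0 + mweight a u'"
    if u: "Poly_Mapping.keys u \<subseteq> {..<n}" and large: "n * M * M \<le> mweight a u" for u
  proof (cases "0 < Poly_Mapping.lookup u 0")
    case True
    then obtain v where "u = Poly_Mapping.single 0 1 + v" "Poly_Mapping.keys v \<subseteq> Poly_Mapping.keys u"
      using poly_mapping_split[of 1 u 0] by auto
    with u show ?thesis using J_closed(2) by (intro exI[of _ v]) auto
  next
    case False
    \<comment> \<open>If all \<open>n\<close> exponents were below \<open>M\<close>, the weight
      would be below \<open>n * M * M\<close>. An exponent of at least \<open>M \<ge> a ! 0\<close>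
      lets \<open>x_i^(a_0)\<close> be exchanged for \<open>x_0^(a_i)\<close>, which is divisible by
      \<open>x_0\<close>.\<close>
    have "\<exists>i<n. M \<le> Poly_Mapping.lookup u i"
    proof (rule ccontr)
      assume small: "\<not> ?thesis"
      have "mweight a u = (\<Sum>i<n. Poly_Mapping.lookup u i * a ! i)"
        using u by (intro mweight_superset) auto
      also have "\<dots> < (\<Sum>i<n. M * M)"
        using small n ai by (intro sum_strict_mono mult_less_le_imp_less) (auto simp: not_le)
      finally show False using large by (simp add: mult.assoc)
    qed
    then obtain i where i: "i < n" "M \<le> Poly_Mapping.lookup u i" by blast
    then have "a ! 0 \<le> Poly_Mapping.lookup u i" using ai(2)[OF n] by simp
    then obtain v where v: "u = Poly_Mapping.single i (a ! 0) + v"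
      "Poly_Mapping.keys v \<subseteq> Poly_Mapping.keys u"
      using poly_mapping_split[of "a ! 0" u i] by auto
    \<comment> \<open>Both monomials of the exchange have degree at most \<open>M\<close>, so their
      binomial falls under \<open>bin\<close>.\<close>
    have "1 \<le> n * M" using n M by (simp add: Suc_le_eq)
    from mult_le_mono1[OF this, of M] have bound: "x \<le> n * M * M" if "x \<le> M" for x
      using that by linarith
    have "?E (Poly_Mapping.single i (a ! 0)) (Poly_Mapping.single 0 (a ! i))"
      using i n bound ai by (intro bin) (auto simp: n_def)
    then have "?E (v + Poly_Mapping.single i (a ! 0)) (v + Poly_Mapping.single 0 (a ! i))"
      using u v(2) by (intro E_add) auto
    moreover define u' where "u' = Poly_Mapping.single 0 (a ! i - 1) + v"
    moreover have split: "Poly_Mapping.single 0 (a ! i) =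
        Poly_Mapping.single 0 1 + Poly_Mapping.single (0::nat) (a ! i - 1)"
      using ai(1)[OF i(1)] by (simp add: single_add[symmetric])
    ultimately have "?E u (Poly_Mapping.single 0 1 + u')"
      using v(1) by (simp add: add_ac)
    moreover have "Poly_Mapping.keys u' \<subseteq> {..<n}"
      using keys_add[of "Poly_Mapping.single 0 (a ! i - 1)" v] u v(2) n
      by (auto simp: u'_def split: if_splits)
    moreover have "mweight a u = a ! 0 + mweight a u'"
    proof -
      have "a ! 0 + mweight a u' = mweight a (Poly_Mapping.single 0 (a ! i) + v)"
        unfolding u'_def split by simp
      then show ?thesis using v(1) by (simp add: mult.commute)
    qed
    ultimately show ?thesis by blast
  qed
  show "?E u v"
    if "Poly_Mapping.keys u \<subseteq> {..<length a}" "Poly_Mapping.keys v \<subseteq> {..<length a}"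
      "mweight a u = mweight a v" for u v
    using that
  proof (induction "mweight a u" arbitrary: u v rule: less_induct)
    case less
    show ?case
    proof (cases "n * M * M \<le> mweight a u")
      case True
      obtain u' where u': "Poly_Mapping.keys u' \<subseteq> {..<n}" "?E u (Poly_Mapping.single 0 1 + u')"
        "mweight a u = a ! 0 + mweight a u'"
        using factor[of u] less.prems True by (auto simp: n_def)
      obtain v' where v': "Poly_Mapping.keys v' \<subseteq> {..<n}" "?E v (Poly_Mapping.single 0 1 + v')"
        "mweight a v = a ! 0 + mweight a v'"
        using factor[of v] less.prems True by (auto simp: n_def)
      \<comment> \<open>Cancelling \<open>x_0\<close> lowers the weight by \<open>a ! 0 > 0\<close>,
        so the induction hypothesis applies.\<close>
      have "?E u' v'"
        using u' v' less.prems ai(1)[OF n] by (intro less.hyps) (auto simp: n_def)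
      then have "?E (Poly_Mapping.single 0 1 + u') (Poly_Mapping.single 0 1 + v')"
        using n by (intro E_add) auto
      then show ?thesis using u'(2) v'(2) E_trans E_sym by blast
    next
      case False
      \<comment> \<open>Below the threshold the degree is bounded by the weight, as all entries of
        \<open>a\<close> are at least 1.\<close>
      have "mdegree n w \<le> 1 * mweight a w" if "Poly_Mapping.keys w \<subseteq> {..<n}" for w
        using that ai by (intro mweight_mono) (auto simp: Suc_le_eq subset_iff)
      then show ?thesis
        using less.prems False by (intro bin) (fastforce simp: n_def)+
    qed
  qed
qed

section \<open>Dehomogenization\<close>

abbreviation dehom_monom :: "(nat \<Rightarrow>\<^sub>0 nat) \<Rightarrow> nat \<Rightarrow>\<^sub>0 nat" where
  "dehom_monom \<equiv> Poly_Mapping.map_key Suc"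

text \<open>The substitution \<open>x\<^sub>0 \<mapsto> 1\<close>, followed by the renumbering \<open>x\<^bsub>i+1\<^esub> \<mapsto> x\<^sub>i\<close>.\<close>

definition dehom :: "'k::field mpoly \<Rightarrow> 'k mpoly" where
  "dehom = lin_ext (Poly_Mapping.single 0) (\<lambda>\<mu>. Poly_Mapping.single (dehom_monom \<mu>) 1)"

interpretation dehom: mpoly_hom "Poly_Mapping.single 0"
  "\<lambda>\<mu>. Poly_Mapping.single (dehom_monom \<mu>) 1"
  by unfold_locales (simp_all add: mult_single single_add map_key_plus)

lemma lookup_dehom_monom: "Poly_Mapping.lookup (dehom_monom \<mu>) i = Poly_Mapping.lookup \<mu> (Suc i)"
  by (simp add: map_key.rep_eq)

lemma keys_dehom_monom:
  "Poly_Mapping.keys \<mu> \<subseteq> {..<Suc n} \<Longrightarrow> Poly_Mapping.keys (dehom_monom \<mu>) \<subseteq> {..<n}"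
  by (auto simp: keys_map_key)

lemma dehom_single: "dehom (Poly_Mapping.single \<mu> c) = Poly_Mapping.single (dehom_monom \<mu>) c"
  by (simp add: dehom_def dehom.single mult_single)

lemma dehom_in_carrier:
  assumes "p \<in> carrier (mpoly_ring (Suc n))"
  shows "dehom p \<in> carrier (mpoly_ring n)"
  unfolding dehom_def lin_ext_def using assms
  by (intro carrier_mpoly_sum)
    (auto simp: mult_single carrier_mpoly_ring_iff dest!: keys_dehom_monom intro!: single_in_carrier)

text \<open>The exponent \<open>k\<close> of \<open>x_0\<close> stays free, so that the total degree
  can be raised to a prescribed value.\<close>

lemma homogenize_monom:
  assumes "Poly_Mapping.keys u \<subseteq> {..<n}"
  obtains u' where "Poly_Mapping.keys u' \<subseteq> {..<Suc n}" "dehom_monom u' = u" "Poly_Mapping.lookup u' 0 = k"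
proof
  define u' where "u' = Poly_Mapping.single 0 k +
    (\<Sum>i\<in>Poly_Mapping.keys u. Poly_Mapping.single (Suc i) (Poly_Mapping.lookup u i))"
  have Suc: "Poly_Mapping.lookup u' (Suc i) = Poly_Mapping.lookup u i" for i
    by (auto simp: u'_def lookup_add lookup_sum lookup_single when_def in_keys_iff)
  then show "dehom_monom u' = u" by (intro poly_mapping_eqI) (simp add: lookup_dehom_monom)
  show "Poly_Mapping.lookup u' 0 = k"
    by (simp add: u'_def lookup_add lookup_sum lookup_single when_def)
  show "Poly_Mapping.keys u' \<subseteq> {..<Suc n}"
  proof
    fix i assume "i \<in> Poly_Mapping.keys u'"
    then show "i \<in> {..<Suc n}" using assms Suc by (cases i) (auto simp: in_keys_iff subset_iff)
  qed
qed

lemma mweight_Suc: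
  assumes "Poly_Mapping.keys \<mu> \<subseteq> {..<Suc (length e)}"
  shows "mweight (x # e) \<mu> = x * Poly_Mapping.lookup \<mu> 0 + mweight e (dehom_monom \<mu>)"
proof -
  have "mweight (x # e) \<mu> = (\<Sum>i<Suc (length e). Poly_Mapping.lookup \<mu> i * (x # e) ! i)"
    using assms by (intro mweight_superset) auto
  also have "\<dots> = x * Poly_Mapping.lookup \<mu> 0 +
      (\<Sum>i<length e. Poly_Mapping.lookup (dehom_monom \<mu>) i * e ! i)"
    unfolding sum.lessThan_Suc_shift by (simp add: lookup_dehom_monom)
  also have "(\<Sum>i<length e. Poly_Mapping.lookup (dehom_monom \<mu>) i * e ! i) = mweight e (dehom_monom \<mu>)"
    using keys_dehom_monom[OF assms] by (intro mweight_superset[symmetric]) auto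
  finally show ?thesis .
qed

lemma mweight_map_add:
  assumes "Poly_Mapping.keys \<mu> \<subseteq> {..<length a}"
  shows "mweight (map (\<lambda>x. j + x) a) \<mu> = j * mdegree (length a) \<mu> + mweight a \<mu>"
proof -
  have "j * mdegree (length a) \<mu> = (\<Sum>i\<in>Poly_Mapping.keys \<mu>. j * Poly_Mapping.lookup \<mu> i)"
    unfolding mweight_def sum_distrib_left using assms by (intro sum.cong) auto
  moreover have "mweight (map (\<lambda>x. j + x) a) \<mu> =
      (\<Sum>i\<in>Poly_Mapping.keys \<mu>. j * Poly_Mapping.lookup \<mu> i + Poly_Mapping.lookup \<mu> i * a ! i)"
    unfolding mweight_def using assms by (intro sum.cong) (auto simp: algebra_simps)
  ultimately show ?thesis by (simp add: sum.distrib mweight_def)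
qed

text \<open>Every variable contributes \<open>j\<close> once per degree, and \<open>x_0\<close>
  nothing more. When the second summand is below \<open>j\<close>, this is division by
  \<open>j\<close> with remainder, so the weight determines both the total degree and the weight
  with respect to \<open>a\<close>.\<close>

lemma mweight_shift_seq:
  assumes "Poly_Mapping.keys \<mu> \<subseteq> {..<Suc (length a)}"
  shows "mweight (shift_seq a j) \<mu> =
    j * mdegree (Suc (length a)) \<mu> + mweight a (dehom_monom \<mu>)"
  using mweight_Suc[of \<mu> "map (\<lambda>x. j + x) a" j] mweight_Suc[of \<mu> "replicate (length a) 1" 1]
    mweight_map_add[OF keys_dehom_monom[OF assms], of j] assms
  by (simp add: shift_seq_def algebra_simps)

text \<open>Homogeneity for \<open>e\<close> makes the kernel condition say that all coefficients of
  \<open>g\<close> sum to zero. A common weight \<open>v\<close> for \<open>a\<close> makes the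
  image of \<open>dehom g\<close> this sum times \<open>t^v\<close>.\<close>

lemma dehom_in_curve_ideal:
  fixes g :: "'k::field mpoly"
  assumes g: "g \<in> curve_ideal TYPE('k) e" "homogeneous e w g" and e: "length e = Suc (length a)"
    and a: "\<And>\<mu>. \<mu> \<in> Poly_Mapping.keys g \<Longrightarrow> mweight a (dehom_monom \<mu>) = v"
  shows "dehom g \<in> curve_ideal TYPE('k) a"
proof -
  have "{\<mu> \<in> Poly_Mapping.keys g. mweight e \<mu> = w} = Poly_Mapping.keys g"
    using g(2) by (auto simp: homogeneous_def)
  then have sum0: "(\<Sum>\<mu>\<in>Poly_Mapping.keys g. Poly_Mapping.lookup g \<mu>) = 0"
    using g(1) coeff_curve_map[of e g w] by (simp add: curve_ideal_def)
  have "curve_map a (dehom g) =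
      (\<Sum>\<mu>\<in>Poly_Mapping.keys g. Polynomial.monom (Poly_Mapping.lookup g \<mu>) v)"
    unfolding dehom_def lin_ext_def[of "Poly_Mapping.single 0"] curve_map_eq_lin_ext
      curve_map.sum mult_single curve_map.single
    using a by (intro sum.cong) (simp_all add: smult_monom)
  also have "\<dots> = Polynomial.monom (\<Sum>\<mu>\<in>Poly_Mapping.keys g. Poly_Mapping.lookup g \<mu>) v"
    by (induction rule: finite_induct[OF finite_keys]) (simp_all add: add_monom[symmetric])
  finally show ?thesis
    using dehom_in_carrier[of g "length a"] g(1) e by (simp add: curve_ideal_def sum0)
qed

section \<open>Descent from the shifted sequence\<close>

lemma complete_intersection_seqI:
  fixes a :: "nat list"
  assumes a: "a \<noteq> []" "sorted_wrt (<) a" "\<forall>x\<in>set a. 0 < x"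
    and H: "finite H" "card H \<le> length a - 1" "H \<subseteq> curve_ideal TYPE('k::field) a"
    and gen: "curve_ideal TYPE('k) a \<subseteq> Idl\<^bsub>mpoly_ring (length a)\<^esub> H"
  shows "complete_intersection_seq TYPE('k) a"
proof -
  let ?R = "mpoly_ring (length a) :: 'k mpoly ring"
  interpret R: cring ?R by (rule cring_mpoly_ring)
  note I_closed = ideal_mpoly_closed[OF ideal_curve_ideal[where 'k = 'k, of a]]
  obtain xs where xs: "set xs = H" "distinct xs"
    using H(1) finite_distinct_list by blast
  \<comment> \<open>Padding with zeros reaches the exact length demanded by the definition without
    changing the ideal.\<close>
  define gs where "gs = xs @ replicate (length a - 1 - length xs) 0"
  have "length gs = length a - 1"
    using H(2) distinct_card[OF xs(2)] xs(1) by (simp add: gs_def)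
  moreover have gsI: "set gs \<subseteq> curve_ideal TYPE('k) a"
    using xs(1) H(3) I_closed(2) by (auto simp: gs_def)
  moreover from this have gsC: "set gs \<subseteq> carrier ?R" using I_closed(1) by blast
  moreover have "curve_ideal TYPE('k) a = Idl\<^bsub>?R\<^esub> (set gs)"
  proof
    have "Idl\<^bsub>?R\<^esub> H \<subseteq> Idl\<^bsub>?R\<^esub> (set gs)"
      using R.genideal_self[OF gsC] xs(1)
      by (intro R.genideal_minimal R.genideal_ideal gsC) (auto simp: gs_def)
    with gen show "curve_ideal TYPE('k) a \<subseteq> Idl\<^bsub>?R\<^esub> (set gs)" by blast
    show "Idl\<^bsub>?R\<^esub> (set gs) \<subseteq> curve_ideal TYPE('k) a"
      using ideal_curve_ideal gsI by (rule R.genideal_minimal)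
  qed
  ultimately show ?thesis using a unfolding complete_intersection_seq_def by blast
qed

text \<open>\<open>D\<close> bounds the degrees of the binomials needed for \<open>a\<close>, and
  \<open>D * M < j\<close> keeps the \<open>a\<close>-weight of every monomial of degree at most
  \<open>D\<close> below \<open>j\<close>.\<close>

lemma complete_intersection_unshift:
  fixes a :: "nat list"
  assumes a: "a \<noteq> []" "sorted_wrt (<) a" "\<forall>x\<in>set a. 0 < x \<and> x \<le> M"
    and D: "D = length a * M * M" and j: "D * M < j"
    and ci: "complete_intersection_seq TYPE('k::field) (shift_seq a j)"
  shows "complete_intersection_seq TYPE('k) a"
proof -
  define n where "n = length a"
  define e where "e = shift_seq a j"
  have le: "length e = Suc n" by (simp add: e_def shift_seq_def n_def)
  have e_pos: "\<forall>x\<in>set e. 0 < x" using ci by (simp add: complete_intersection_seq_def e_def)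
  let ?R = "mpoly_ring (Suc n) :: 'k mpoly ring"
  let ?S = "mpoly_ring n :: 'k mpoly ring"
  let ?I = "curve_ideal TYPE('k) e" and ?A = "curve_ideal TYPE('k) a"
  interpret R: cring ?R by (rule cring_mpoly_ring)
  interpret S: cring ?S by (rule cring_mpoly_ring)
  have idI: "ideal ?I ?R" using ideal_curve_ideal[where 'k = 'k, of e] by (simp add: le)
  have idA: "ideal ?A ?S" using ideal_curve_ideal[where 'k = 'k, of a] by (simp add: n_def)
  note A_closed = ideal_mpoly_closed[OF idA]
  obtain gs where gs: "length gs = n" "set gs \<subseteq> carrier ?R" "?I = Idl\<^bsub>?R\<^esub> (set gs)"
    using ci unfolding complete_intersection_seq_def e_def[symmetric] by (auto simp: le)
  have graded: "component e w p \<in> ?I" if "p \<in> ?I" for p w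
    using that curve_map_component_eq_0[of e p w] component_in_carrier[of p "length e" e w]
    by (simp add: curve_ideal_def)
  obtain G d where G: "finite G" "card G \<le> card (set gs)" "G \<subseteq> carrier ?R"
      "Idl\<^bsub>?R\<^esub> G = ?I" "\<And>g. g \<in> G \<Longrightarrow> homogeneous e (d g) g"
  proof (rule homogeneous_generators[of e "set gs"])
    show "\<forall>x\<in>set e. 0 < x" by (rule e_pos)
  qed (use gs graded le in auto)
  have card_G: "card G \<le> n" using G(2) card_length[of gs] gs(1) by simp
  have GI: "G \<subseteq> ?I" using R.genideal_self[OF G(3)] G(4) by simp
  \<comment> \<open>\<open>W\<close> bounds the weights of the lifted binomials, which have degree
    \<open>D\<close> and \<open>a\<close>-weight at most \<open>D * M\<close>. It is also below
    \<open>Suc D * j\<close>, so monomials of weight at most \<open>W\<close> have degree at most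
    \<open>D\<close>.\<close>
  define W where "W = D * (j + M)"
  define Gs where "Gs = {g \<in> G. d g \<le> W}"
  have dehom_Gs: "dehom g \<in> ?A" if "g \<in> Gs" for g
  proof -
    have g: "g \<in> G" "d g \<le> W" using that by (auto simp: Gs_def)
    \<comment> \<open>The \<open>a\<close>-weight is the remainder of \<open>d g\<close> modulo
      \<open>j\<close>, hence the same for all monomials of \<open>g\<close>.\<close>
    have "mweight a (dehom_monom \<mu>) = d g mod j" if \<mu>: "\<mu> \<in> Poly_Mapping.keys g" for \<mu>
    proof -
      have keys: "Poly_Mapping.keys \<mu> \<subseteq> {..<Suc n}"
        using subsetD[OF G(3) g(1)] \<mu> unfolding carrier_mpoly_ring_iff by blast
      have d: "d g = j * mdegree (Suc n) \<mu> + mweight a (dehom_monom \<mu>)"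
        using G(5)[OF g(1)] \<mu> mweight_shift_seq[of \<mu> a j] keys
        by (simp add: homogeneous_def e_def n_def)
      have "D * (j + M) < Suc D * j" using j by (simp add: algebra_simps)
      then have "j * mdegree (Suc n) \<mu> < j * Suc D"
        using d g(2) by (simp add: W_def mult.commute)
      then have deg: "mdegree (Suc n) \<mu> \<le> D"
        by (simp only: mult_less_cancel1 less_Suc_eq_le)
      have "mweight a (dehom_monom \<mu>) \<le> M * mdegree n (dehom_monom \<mu>)"
        using a(3) keys_dehom_monom[OF keys] by (intro mweight_mono) (auto simp: n_def subset_iff)
      also have "\<dots> \<le> M * D"
        using mweight_Suc[of \<mu> "replicate n 1" 1] keys deg by (intro mult_le_mono2) simp
      finally have "mweight a (dehom_monom \<mu>) < j" using j by (simp add: mult.commute)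
      then show ?thesis by (simp add: d)
    qed
    with g GI G(5)[OF g(1)] le show ?thesis
      by (intro dehom_in_curve_ideal[of g e "d g"]) (auto simp: n_def)
  qed
  define H where "H = dehom ` Gs"
  have HA: "H \<subseteq> ?A" using dehom_Gs by (auto simp: H_def)
  then have HS: "H \<subseteq> carrier ?S" using A_closed(1) by blast
  have "Gs \<noteq> G"
  proof
    assume all: "Gs = G"
    \<comment> \<open>The binomial \<open>x_0^(e_1) - x_1^j\<close> becomes \<open>1 - x_0^j\<close>
      after dehomogenization and renumbering; its image \<open>1 - t^(j a_0)\<close> is
      nonzero.\<close>
    define b :: "'k mpoly" where "b = Poly_Mapping.single (Poly_Mapping.single 0 (e ! 1)) (1 :: 'k) -
      Poly_Mapping.single (Poly_Mapping.single 1 j) 1"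
    have n: "0 < n" using a(1) by (simp add: n_def)
    have e01: "e ! 0 = j" by (simp add: e_def shift_seq_def)
    have "b \<in> ?I"
      unfolding b_def using n le by (intro binomial_in_curve_ideal) (auto simp: e01)
    then obtain c where c: "\<forall>g\<in>G. c g \<in> carrier ?R" "b = (\<Sum>g\<in>G. c g * g)"
      using genideal_mpoly_iff[OF G(1,3), of b] G(4) by auto
    have "dehom b = (\<Sum>g\<in>G. dehom (c g) * dehom g)"
      by (simp add: c(2) dehom_def dehom.sum dehom.mult)
    also have "\<dots> \<in> ?A"
      using c(1) dehom_Gs all by (intro ideal_mpoly_sum[OF idA] A_closed(4) dehom_in_carrier) auto
    finally have "curve_map a (dehom b) = 0" by (simp add: curve_ideal_def)
    moreover have "dehom b = Poly_Mapping.single 0 1 - Poly_Mapping.single (Poly_Mapping.single 0 j) 1"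
    proof -
      have "dehom_monom (Poly_Mapping.single 0 (e ! 1)) = 0"
        "dehom_monom (Poly_Mapping.single 1 j) = Poly_Mapping.single 0 j"
        by (auto intro!: poly_mapping_eqI simp: lookup_dehom_monom lookup_single when_def)
      then show ?thesis
        unfolding b_def dehom_def dehom.diff by (simp add: dehom.single mult_single)
    qed
    ultimately have "1 = (Polynomial.monom 1 (j * a ! 0) :: 'k poly)"
      by (simp add: curve_map_eq_lin_ext curve_map.diff curve_map.one curve_map.single)
    then have "Polynomial.coeff 1 0 = Polynomial.coeff (Polynomial.monom (1 :: 'k) (j * a ! 0)) 0"
      by (rule arg_cong)
    then have "j * a ! 0 = 0" by (simp split: if_splits)
    moreover have "0 < a ! 0" using a(1,3) by simp
    ultimately show False using j by simp
  qed
  then have "Gs \<subset> G" by (auto simp: Gs_def)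
  then have "card Gs < card G" using G(1) by (rule psubset_card_mono[rotated])
  then have card_H: "card H \<le> n - 1"
    using card_G card_image_le[of Gs dehom] G(1) by (simp add: H_def Gs_def)
  have idJ: "ideal (Idl\<^bsub>?S\<^esub> H) ?S" using HS by (rule S.genideal_ideal)
  have "?A \<subseteq> Idl\<^bsub>?S\<^esub> H"
  proof (rule curve_ideal_subset_if_small_binomials[OF idJ[unfolded n_def] a(1,3), folded n_def])
    fix u v
    assume keys: "Poly_Mapping.keys u \<subseteq> {..<n}" "Poly_Mapping.keys v \<subseteq> {..<n}"
      and eq: "mweight a u = mweight a v" and deg: "mdegree n u \<le> n * M * M" "mdegree n v \<le> n * M * M"
    \<comment> \<open>Padding with \<open>x_0^(D - mdegree n x)\<close> gives total degree exactly
      \<open>D\<close>, so monomials of equal \<open>a\<close>-weight lift to monomials of equal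
      weight.\<close>
    have hom: "\<exists>x'. Poly_Mapping.keys x' \<subseteq> {..<Suc n} \<and> dehom_monom x' = x \<and>
        mweight e x' = j * D + mweight a x"
      if x: "Poly_Mapping.keys x \<subseteq> {..<n}" "mdegree n x \<le> n * M * M" for x
    proof -
      obtain x' where x': "Poly_Mapping.keys x' \<subseteq> {..<Suc n}" "dehom_monom x' = x"
        "Poly_Mapping.lookup x' 0 = D - mdegree n x"
        using homogenize_monom[OF x(1)] by blast
      then have "mdegree (Suc n) x' = D"
        using mweight_Suc[of x' "replicate n 1" 1] x(2) by (simp add: D n_def)
      then have "mweight e x' = j * D + mweight a x"
        using mweight_shift_seq[of x' a j] x' by (simp add: e_def n_def)
      with x' show ?thesis by blast
    qed
    obtain u' where u': "Poly_Mapping.keys u' \<subseteq> {..<Suc n}" "dehom_monom u' = u"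
      "mweight e u' = j * D + mweight a u" using hom[OF keys(1) deg(1)] by blast
    obtain v' where v': "Poly_Mapping.keys v' \<subseteq> {..<Suc n}" "dehom_monom v' = v"
      "mweight e v' = j * D + mweight a v" using hom[OF keys(2) deg(2)] by blast
    define w where "w = j * D + mweight a u"
    have "mweight a u \<le> M * mdegree n u"
      using a(3) keys(1) by (intro mweight_mono) (auto simp: n_def subset_iff)
    also have "\<dots> \<le> M * D" using deg(1) by (simp add: D n_def)
    finally have wW: "w \<le> W" by (simp add: w_def W_def algebra_simps)
    define b :: "'k mpoly" where "b = Poly_Mapping.single u' (1 :: 'k) - Poly_Mapping.single v' 1"
    have "b \<in> ?I"
      unfolding b_def using u' v' eq le by (intro binomial_in_curve_ideal) auto
    then obtain c where c: "\<forall>g\<in>G. c g \<in> carrier ?R" "b = (\<Sum>g\<in>G. c g * g)"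
      using genideal_mpoly_iff[OF G(1,3), of b] G(4) by auto
    have "homogeneous e w b"
      using u'(3) v'(3) eq
      by (auto simp: homogeneous_def b_def w_def in_keys_iff lookup_minus lookup_single when_def
          split: if_splits)
    \<comment> \<open>Taking the component of weight \<open>w \<le> W\<close> removes every
      generator of weight above \<open>w\<close>, so only elements of \<open>Gs\<close>
      remain.\<close>
    then have "b = component e w b" by (simp add: grading_homogeneous)
    also have "\<dots> = (\<Sum>g\<in>G. if d g \<le> w then component e (w - d g) (c g) * g else 0)"
      unfolding c(2) component_sum
      by (intro sum.cong) (simp_all add: component_mult_homogeneous[OF G(5)])
    finally have "dehom b = (\<Sum>g\<in>G. dehom (if d g \<le> w then component e (w - d g) (c g) * g else 0))"
      by (simp add: dehom_def dehom.sum)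
    also have "\<dots> \<in> Idl\<^bsub>?S\<^esub> H"
    proof (rule ideal_mpoly_sum[OF idJ])
      fix g assume g: "g \<in> G"
      show "dehom (if d g \<le> w then component e (w - d g) (c g) * g else 0) \<in> Idl\<^bsub>?S\<^esub> H"
      proof (cases "d g \<le> w")
        case True
        then have "dehom g \<in> H" using g wW by (auto simp: H_def Gs_def)
        then have "dehom g \<in> Idl\<^bsub>?S\<^esub> H" using S.genideal_self[OF HS] by blast
        moreover have "dehom (component e (w - d g) (c g)) \<in> carrier ?S"
          using c(1) g by (intro dehom_in_carrier component_in_carrier) auto
        ultimately show ?thesis
          using True ideal_mpoly_closed(4)[OF idJ] by (simp add: dehom_def dehom.mult)
      next
        case False
        then show ?thesis
          using ideal_mpoly_closed(2)[OF idJ] by (simp add: dehom_def dehom.zero)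
      qed
    qed
    finally show "Poly_Mapping.single u 1 - Poly_Mapping.single v 1 \<in> Idl\<^bsub>?S\<^esub> H"
      using u'(2) v'(2) dehom_single[of u' "1 :: 'k"] dehom_single[of v' "1 :: 'k"]
      by (simp add: b_def dehom_def dehom.diff)
  qed
  then show ?thesis
    using a card_H HA G(1)
    by (intro complete_intersection_seqI[of a H]) (auto simp: n_def H_def Gs_def)
qed

theorem corollary2p2:
  fixes a :: "nat list"
  assumes "a \<noteq> []"
    and "sorted_wrt (<) a"
    and "\<forall>x\<in>set a. 0 < x"
  shows "\<exists>N::nat. \<forall>j::nat. N \<le> j \<and> 0 < j \<longrightarrow>
    complete_intersection_seq TYPE('k::field_char_0) (shift_seq a j) \<longrightarrow>
    complete_intersection_seq TYPE('k) a"
proof -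
  define M where "M = sum_list a"
  have "\<forall>x\<in>set a. 0 < x \<and> x \<le> M" using assms(3) by (auto simp: M_def intro: member_le_sum_list)
  then show ?thesis
    using complete_intersection_unshift[OF assms(1,2), of M "length a * M * M", where 'k = 'k]
    \<comment> \<open>The successor supplies the strict inequality \<open>D * M < j\<close>.\<close>
    by (intro exI[of _ "Suc (length a * M * M * M)"]) (auto simp: Suc_le_eq)
qed

end
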